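(* Consider the Kuramoto-Sakaguchi model $$\dot x_i=f_i(\bm{x})=\omega_i-\sum_{j=1}^n a_{ij}\left[\sin(x_i-x_j-\varphi)+\sin\varphi\right],\qquad i=1,\dots,n,$$ with $\omega_i\in\mathbb{R}$, on a weighted, connected, undirected graph $\mathcal G$, with frustration parameter $\varphi\in[0,\pi/2]$. Let $\lambda_2$ and $d_{\max}$ be the algebraic connectivity and the maximal weighted degree of $\mathcal G$, let $$\bar\gamma=\arctan\left[\frac{\lambda_2}{d_{\max}\tan(\varphi)}\right],$$ let $0<\gamma<\bar\gamma$, let $\Sigma=(\sigma_1,\dots,\sigma_c)$ be a collection of cycles of $\mathcal G$, and let $\bm{u}\in\mathbb{Z}^c$. Then, up to a constant phase shift and up to the addition of integer multiples of $2\pi$, there is at most one synchronous state of the model in the $\gamma$-cohesive $\bm{u}$-winding cell $\Gamma(\bm{u},\gamma)$. That is, if $\bm{x}^{\rm s},\bm{x}^{\rm t}\in\Gamma(\bm{u},\gamma)$ are synchronous states, then there exist $\rho\in\mathbb{R}$ and $\bm{\ell}\in\mathbb{Z}^n$ with $\bm{x}^{\rm s}-\bm{x}^{\rm t}=\rho\bm{1}_n+2\pi\bm{\ell}$.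
   Context: $\mathcal G$ is a weighted, undirected, connected graph (without self-loops) on $n\ge 2$ vertices, with symmetric weights $a_{ij}=a_{ji}$, where $a_{ij}>0$ if $(i,j)$ is an edge and $a_{ij}=0$ otherwise. Its Laplacian $L_{\mathcal G}$ has entries $-a_{ij}$ for $i\ne j$ and $\sum_k a_{ik}$ on the diagonal; its second smallest eigenvalue $\lambda_2>0$ is the algebraic connectivity. The weighted degree of vertex $i$ is $\sum_j a_{ij}$, and $d_{\max}$ is the maximum of these. $\bm{1}_n$ is the all-ones vector. Convention for the endpoints: $\bar\gamma\in(0,\pi/2)$ for $\varphi\in(0,\pi/2)$; for $\varphi=0$ the formula is read as $\bar\gamma=\pi/2$, and for $\varphi=\pi/2$ as $\bar\gamma=0$ (so that the claim is then vacuous). A (frequency) synchronous state is an $\bm{x}^{\rm s}\in\mathbb{R}^n$ such that, for some $\omega^{\rm s}\in\mathbb{R}$ (the synchronous frequency), $f_i(\bm{x}^{\rm s})=\omega^{\rm s}$ for all $i$. Different synchronous states may a priori have different $\omega^{\rm s}$. Counterclockwise difference: for $x_1,x_2\in\mathbb{R}$, $d_{\rm cc}(x_1,x_2)=x_1-x_2+2\pi k$ with $k\in\mathbb{Z}$ such that the value lies in $[-\pi,\pi)$. For $\gamma\in[0,\pi]$, a state $\bm{x}\in\mathbb{R}^n$ is $\gamma$-cohesive if $|d_{\rm cc}(x_i,x_j)|\le\gamma$ for every edge $(i,j)$ of $\mathcal G$; $\Delta_{\mathcal G}(\gamma)$ is the set of all $\gamma$-cohesive states. A simple path in $\mathcal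 G$ is a sequence of pairwise distinct vertices in which consecutive vertices are adjacent; a cycle $\sigma=(i_0,i_1,\dots,i_\ell=i_0)$ is a simple path whose two ends are adjacent, closed up. The winding number of $\bm{x}\in\mathbb{R}^n$ along $\sigma$ is $q_\sigma(\bm{x})=\frac{1}{2\pi}\sum_{j=1}^{\ell}d_{\rm cc}(x_{i_{j-1}},x_{i_j})\in\mathbb{Z}$. For a collection of cycles $\Sigma=(\sigma_1,\dots,\sigma_c)$ of $\mathcal G$, the winding vector is $q_\Sigma(\bm{x})=[q_{\sigma_1}(\bm{x}),\dots,q_{\sigma_c}(\bm{x})]^\top\in\mathbb{Z}^c$, the $\bm{u}$-winding cell is $\Omega_\Sigma(\bm{u})=\{\bm{x}\in\mathbb{R}^n: q_\Sigma(\bm{x})=\bm{u}\}$, and the $\gamma$-cohesive $\bm{u}$-winding cell is $\Gamma(\bm{u},\gamma)=\Omega_\Sigma(\bm{u})\cap\Delta_{\mathcal G}(\gamma)$.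
   Formalization: The collection of cycles Σ is additionally assumed to generate the cycle space of the graph (over the reals); for arbitrary collections the claim is false, e.g. two pentagons joined by a bridge with φ=0 and only one pentagon in Σ. *)

theory Defs
  imports "HOL-Analysis.Analysis" "HOL-Computational_Algebra.Polynomial"
begin

text \<open>A weighted graph on the vertex set \<open>UNIV :: 'n set\<close> is given by its weight matrix;
  vertices \<open>i\<close> and \<open>j\<close> are adjacent iff \<open>a $ i $ j > 0\<close>.\<close>

definition weighted_graph :: "real ^ 'n ^ 'n \<Rightarrow> bool" where
  "weighted_graph a \<longleftrightarrow>
     (\<forall>i j. a $ i $ j = a $ j $ i) \<and> (\<forall>i j. a $ i $ j \<ge> 0) \<and> (\<forall>i. a $ i $ i = 0)"

definition adj :: "real ^ 'n ^ 'n \<Rightarrow> 'n \<Rightarrow> 'n \<Rightarrow> bool" where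
  "adj a i j \<longleftrightarrow> a $ i $ j > 0"

definition connected_graph :: "real ^ 'n ^ 'n \<Rightarrow> bool" where
  "connected_graph a \<longleftrightarrow> (\<forall>i j. (i, j) \<in> {(k, l). adj a k l}\<^sup>*)"

definition weighted_degree :: "real ^ 'n ^ 'n \<Rightarrow> 'n \<Rightarrow> real" where
  "weighted_degree a i = (\<Sum>j\<in>UNIV. a $ i $ j)"

definition max_degree :: "real ^ 'n ^ 'n \<Rightarrow> real" where
  "max_degree a = Max (range (weighted_degree a))"

definition laplacian :: "real ^ 'n ^ 'n \<Rightarrow> real ^ 'n ^ 'n" where
  "laplacian a = (\<chi> i j. if i = j then (\<Sum>k\<in>UNIV. a $ i $ k) else - a $ i $ j)"

definition charpoly :: "real ^ 'n ^ 'n \<Rightarrow> real poly" where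
  "charpoly A = det (\<chi> i j. (if i = j then [:0, 1:] else 0) - [:A $ i $ j:])"

text \<open>The real eigenvalues in increasing order, repeated according to algebraic multiplicity.
  For a symmetric matrix the list has length \<open>CARD('n)\<close>, so that entry \<open>1\<close> (counting from \<open>0\<close>)
  exists as soon as \<open>CARD('n) \<ge> 2\<close>.\<close>

definition eigenvalue_list :: "real ^ 'n ^ 'n \<Rightarrow> real list" where
  "eigenvalue_list A = sorted_list_of_multiset (proots (charpoly A))"

definition algebraic_connectivity :: "real ^ 'n ^ 'n \<Rightarrow> real" where
  "algebraic_connectivity a = eigenvalue_list (laplacian a) ! 1"

text \<open>The two endpoint cases are spelled out because division by zero and \<open>tan (pi / 2)\<close>
  are total in HOL; for \<open>\<phi> = 0\<close> the last branch would give \<open>0\<close> instead of \<open>pi / 2\<close>.\<close>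

definition gamma_bar :: "real ^ 'n ^ 'n \<Rightarrow> real \<Rightarrow> real" where
  "gamma_bar a \<phi> =
     (if \<phi> = 0 then pi / 2
      else if \<phi> = pi / 2 then 0
      else arctan (algebraic_connectivity a / (max_degree a * tan \<phi>)))"

definition kuramoto_sakaguchi ::
  "real ^ 'n ^ 'n \<Rightarrow> real ^ 'n \<Rightarrow> real \<Rightarrow> real ^ 'n \<Rightarrow> real ^ 'n" where
  "kuramoto_sakaguchi a \<omega> \<phi> x =
     (\<chi> i. \<omega> $ i - (\<Sum>j\<in>UNIV. a $ i $ j * (sin (x $ i - x $ j - \<phi>) + sin \<phi>)))"

definition synchronous_state :: "(real ^ 'n \<Rightarrow> real ^ 'n) \<Rightarrow> real ^ 'n \<Rightarrow> bool" where
  "synchronous_state f x \<longleftrightarrow> (\<exists>\<omega>s. \<forall>i. f x $ i = \<omega>s)"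

definition dcc :: "real \<Rightarrow> real \<Rightarrow> real" where
  "dcc x y = (THE d. (\<exists>k::int. d = x - y + 2 * pi * of_int k) \<and> - pi \<le> d \<and> d < pi)"

lemma dcc_ex1:
  fixes x y :: real
  shows "\<exists>!d. (\<exists>k::int. d = x - y + 2 * pi * of_int k) \<and> - pi \<le> d \<and> d < pi"
proof (rule ex_ex1I)
  define m where "m = \<lfloor>(x - y + pi) / (2 * pi)\<rfloor>"
  have "of_int m \<le> (x - y + pi) / (2 * pi)" "(x - y + pi) / (2 * pi) < of_int m + 1"
    unfolding m_def by linarith+
  then have "2 * pi * of_int m \<le> x - y + pi" "x - y + pi < 2 * pi * of_int m + 2 * pi"
    by (simp_all add: field_simps)
  then have "x - y + 2 * pi * of_int (- m) = x - y + 2 * pi * of_int (- m)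
      \<and> - pi \<le> x - y + 2 * pi * of_int (- m) \<and> x - y + 2 * pi * of_int (- m) < pi"
    by simp
  then show "\<exists>d. (\<exists>k::int. d = x - y + 2 * pi * of_int k) \<and> - pi \<le> d \<and> d < pi"
    by blast
next
  fix d e
  assume "(\<exists>k::int. d = x - y + 2 * pi * of_int k) \<and> - pi \<le> d \<and> d < pi"
    and "(\<exists>k::int. e = x - y + 2 * pi * of_int k) \<and> - pi \<le> e \<and> e < pi"
  then obtain k l :: int where
    d: "d = x - y + 2 * pi * of_int k" "- pi \<le> d" "d < pi" and
    e: "e = x - y + 2 * pi * of_int l" "- pi \<le> e" "e < pi"
    by blast
  have "\<bar>d - e\<bar> < 2 * pi * 1"
    using d(2,3) e(2,3) by linarith
  moreover have "\<bar>d - e\<bar> = 2 * pi * of_int \<bar>k - l\<bar>"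
  proof -
    have "d - e = 2 * pi * of_int (k - l)"
      using d(1) e(1) by (simp add: algebra_simps)
    then show ?thesis
      by (simp add: abs_mult)
  qed
  ultimately have "(of_int \<bar>k - l\<bar> :: real) < 1"
    using pi_gt_zero by (metis mult_less_cancel_left_pos zero_less_mult_iff zero_less_numeral)
  then have "k = l"
    by linarith
  then show "d = e"
    using d(1) e(1) by simp
qed

definition cohesive_set :: "real ^ 'n ^ 'n \<Rightarrow> real \<Rightarrow> (real ^ 'n) set" where
  "cohesive_set a \<gamma> = {x. \<forall>i j. adj a i j \<longrightarrow> \<bar>dcc (x $ i) (x $ j)\<bar> \<le> \<gamma>}"

text \<open>The cycle \<open>(i\<^sub>0, \<dots>, i\<^sub>\<ell> = i\<^sub>0)\<close> is represented by the list \<open>[i\<^sub>0, \<dots>, i\<^sub>(\<ell> - 1)]\<close>.\<close>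

definition simple_path :: "real ^ 'n ^ 'n \<Rightarrow> 'n list \<Rightarrow> bool" where
  "simple_path a vs \<longleftrightarrow> distinct vs \<and> successively (adj a) vs"

definition is_cycle :: "real ^ 'n ^ 'n \<Rightarrow> 'n list \<Rightarrow> bool" where
  "is_cycle a vs \<longleftrightarrow> vs \<noteq> [] \<and> simple_path a vs \<and> adj a (last vs) (hd vs)"

text \<open>The \<open>k\<close>-th arc of a cycle; the last one (\<open>k = length vs - 1\<close>) returns to the start.\<close>

definition cycle_arc :: "'n list \<Rightarrow> nat \<Rightarrow> 'n \<times> 'n" where
  "cycle_arc vs k = (vs ! k, vs ! (Suc k mod length vs))"

definition cycle_winding :: "real ^ 'n \<Rightarrow> 'n list \<Rightarrow> real" where
  "cycle_winding x vs =
     1 / (2 * pi) *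
       (\<Sum>k<length vs. dcc (x $ fst (cycle_arc vs k)) (x $ snd (cycle_arc vs k)))"

definition winding_vector :: "'n list list \<Rightarrow> real ^ 'n \<Rightarrow> real list" where
  "winding_vector \<Sigma> x = map (cycle_winding x) \<Sigma>"

definition winding_cell :: "'n list list \<Rightarrow> int list \<Rightarrow> (real ^ 'n) set" where
  "winding_cell \<Sigma> u = {x. winding_vector \<Sigma> x = map of_int u}"

definition cohesive_winding_cell ::
  "real ^ 'n ^ 'n \<Rightarrow> 'n list list \<Rightarrow> int list \<Rightarrow> real \<Rightarrow> (real ^ 'n) set" where
  "cohesive_winding_cell a \<Sigma> u \<gamma> = winding_cell \<Sigma> u \<inter> cohesive_set a \<gamma>"

text \<open>The signed edge-incidence vector of a cycle, as an antisymmetric matrix.\<close>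

definition cycle_vector :: "'n list \<Rightarrow> real ^ 'n ^ 'n" where
  "cycle_vector vs =
     (\<chi> i j. real (card {k. k < length vs \<and> cycle_arc vs k = (i, j)})
           - real (card {k. k < length vs \<and> cycle_arc vs k = (j, i)}))"

text \<open>The cycle space is spanned by all cycles of the graph. A collection of cycles may contain
  redundant members, but has to generate the cycle space: otherwise the winding vector does not
  separate winding cells. For instance, on a pentagon with unit weights, \<open>\<phi> = 0\<close> and
  \<open>\<omega> = 0\<close>, both the constant state and the splay state \<open>x\<^sub>k = 2 k pi / 5\<close> are synchronous and
  \<open>\<gamma>\<close>-cohesive for \<open>\<gamma> = 2 pi / 5 < pi / 2\<close>, and only the winding number along the pentagon
  distinguishes them. Every cycle basis (integral, or over a field) satisfies this condition.\<close>

definition cycle_space :: "real ^ 'n ^ 'n \<Rightarrow> (real ^ 'n ^ 'n) set" where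
  "cycle_space a = span (cycle_vector ` {vs. is_cycle a vs})"

definition generates_cycle_space :: "real ^ 'n ^ 'n \<Rightarrow> 'n list list \<Rightarrow> bool" where
  "generates_cycle_space a \<Sigma> \<longleftrightarrow> span (cycle_vector ` set \<Sigma>) = cycle_space a"

end

theory Submission
  imports Defs
begin

text \<open>
  Let \<open>\<theta>\<close> and \<open>\<eta>\<close> be the counterclockwise differences of two synchronous states along the edges.
  Both states have the same winding numbers along cycles that span the cycle space, so
  \<open>\<theta> - \<eta>\<close> sums to zero around every cycle, hence around every closed walk, and is therefore the
  difference \<open>p\<^sub>i - p\<^sub>j\<close> of a potential \<open>p\<close> (\<open>winding_cell_potential\<close>). The potential is a lift of
  \<open>x\<^sup>s - x\<^sup>t\<close> modulo \<open>2\<pi>\<close>, up to an additive constant, and it remains to see that it is constant.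

  Normalise \<open>p\<close> to mean zero and pair the difference of the two synchrony equations with \<open>p\<close>; the
  difference of the synchronous frequencies drops out. Splitting
  \<open>sin (\<theta> - \<phi>) = cos \<phi> sin \<theta> - sin \<phi> cos \<theta>\<close> separates the coupling into a part that is odd in the
  orientation of an edge and one that is even. On \<open>[-\<gamma>, \<gamma>]\<close> the slope of \<open>sin\<close> is at least \<open>cos \<gamma>\<close>,
  so the odd part contributes at least \<open>cos \<phi> cos \<gamma>\<close> times the Laplacian form of \<open>p\<close>; the slope
  of \<open>cos\<close> is at most \<open>sin \<gamma>\<close> in absolute value, so the even part contributes at most
  \<open>sin \<phi> sin \<gamma> d\<^sub>m\<^sub>a\<^sub>x \<bar>p\<bar>\<^sup>2\<close>. This is \<open>energy_inequality\<close>. Since the Laplacian form is at least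
  \<open>\<lambda>\<^sub>2 \<bar>p\<bar>\<^sup>2\<close> on vectors of mean zero (\<open>algebraic_connectivity_le_Rayleigh\<close>), a nonzero \<open>p\<close> would
  give \<open>\<lambda>\<^sub>2 \<le> d\<^sub>m\<^sub>a\<^sub>x tan \<phi> tan \<gamma>\<close>, against the bound on \<open>\<gamma>\<close> if \<open>0 < \<phi> < \<pi> / 2\<close>; the endpoints are
  treated in \<open>potential_constant\<close>.
\<close>

section \<open>Closed walks and potentials\<close>

fun walk_sum :: "('v \<Rightarrow> 'v \<Rightarrow> real) \<Rightarrow> 'v list \<Rightarrow> real" where
  "walk_sum D (v # w # ws) = D v w + walk_sum D (w # ws)"
| "walk_sum D _ = 0"

lemma walk_sum_append:
  "walk_sum D (us @ v # ws) = walk_sum D (us @ [v]) + walk_sum D (v # ws)"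
  by (induction us rule: induct_list012) simp_all

lemma walk_sum_rev:
  assumes "\<And>i j. E i j \<Longrightarrow> D j i = - D i j" and "successively E ws"
  shows "walk_sum D (rev ws) = - walk_sum D ws"
  using assms(2)
proof (induction ws rule: induct_list012)
  case (3 v w ws)
  then show ?case
    using assms(1)[of v w] walk_sum_append[of D "rev ws" w "[v]"] by simp
qed auto

lemma walk_sum_conv_sum:
  "walk_sum D ws = (\<Sum>k<length ws - 1. D (ws ! k) (ws ! Suc k))"
  by (induction D ws rule: walk_sum.induct) (simp_all add: sum.lessThan_Suc_shift del: sum.lessThan_Suc)

lemma walk_sum_cycle:
  "walk_sum D (vs @ [hd vs]) = (\<Sum>k<length vs. case_prod D (cycle_arc vs k))"
proof (cases "vs = []")
  case False
  have "D ((vs @ [hd vs]) ! k) ((vs @ [hd vs]) ! Suc k) = case_prod D (cycle_arc vs k)"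
    if "k < length vs" for k
  proof (cases "Suc k < length vs")
    case True
    then show ?thesis by (simp add: cycle_arc_def nth_append)
  next
    case last: False
    then have "Suc k = length vs"
      using that by simp
    then show ?thesis
      using False that by (simp add: cycle_arc_def nth_append hd_conv_nth)
  qed
  then show ?thesis
    by (simp add: walk_sum_conv_sum)
qed simp

text \<open>A closed walk that is not a cycle visits some vertex twice and splits there into two shorter
  closed walks, whose sums add up.\<close>

lemma walk_sum_closed_walk_eq_0:
  assumes cycles: "\<And>vs. vs \<noteq> [] \<Longrightarrow> distinct vs \<Longrightarrow> successively E vs \<Longrightarrow> E (last vs) (hd vs)
      \<Longrightarrow> walk_sum D (vs @ [hd vs]) = 0"
    and "ws \<noteq> []" and "successively E ws" and "last ws = hd ws"
  shows "walk_sum D ws = 0"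
proof -
  have closed: "walk_sum D (vs @ [hd vs]) = 0"
    if "vs \<noteq> []" "successively E vs" "E (last vs) (hd vs)" for vs
    using that
  proof (induction vs rule: length_induct)
    case (1 vs)
    show ?case
    proof (cases "distinct vs")
      case True
      then show ?thesis using 1 cycles by blast
    next
      case False
      then obtain us y ys zs where vs: "vs = us @ [y] @ ys @ [y] @ zs"
        using not_distinct_decomp by blast
      \<comment> \<open>The loop \<open>y # ys\<close> is cut out; what remains is the closed walk \<open>us @ y # zs\<close>.\<close>
      have hd: "hd (us @ y # zs) = hd vs"
        unfolding vs by (cases us) auto
      have last: "last (us @ y # zs) = last vs"
        unfolding vs by (cases zs) auto
      have "successively E (us @ ((y # ys) @ [y]) @ zs)"
        using 1(3) by (simp add: vs)
      then have "successively E ((y # ys) @ [y])"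
        by (simp only: successively_append_iff)
      then have "successively E (y # ys)" "E (last (y # ys)) (hd (y # ys))"
        unfolding successively_append_iff by simp_all
      then have "walk_sum D ((y # ys) @ [hd (y # ys)]) = 0"
        by (intro 1(1)[rule_format]) (auto simp: vs)
      moreover have "walk_sum D ((us @ y # zs) @ [hd (us @ y # zs)]) = 0"
      proof (intro 1(1)[rule_format])
        show "successively E (us @ y # zs)"
          using 1(3) unfolding vs by (auto simp: successively_append_iff successively_Cons)
        show "E (last (us @ y # zs)) (hd (us @ y # zs))"
          using 1(4) hd last by simp
      qed (auto simp: vs)
      ultimately show ?thesis
        using walk_sum_append[of D us y "ys @ [y] @ zs @ [hd vs]"]
          walk_sum_append[of D "y # ys" y "zs @ [hd vs]"]
          walk_sum_append[of D us y "zs @ [hd vs]"] arg_cong[OF vs, of "\<lambda>l. walk_sum D (l @ [hd vs])"]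
        unfolding hd append_assoc append.simps list.sel by linarith
    qed
  qed
  obtain vs v where ws: "ws = vs @ [v]"
    using assms(2) by (metis rev_exhaust)
  show ?thesis
  proof (cases "vs = []")
    case True
    then show ?thesis by (simp add: ws)
  next
    case False
    then show ?thesis
      using closed[of vs] assms(3,4) by (simp add: ws successively_append_iff)
  qed
qed

lemma walk_exists:
  assumes "(i, j) \<in> {(k, l). E k l}\<^sup>*"
  shows "\<exists>ws. ws \<noteq> [] \<and> hd ws = i \<and> last ws = j \<and> successively E ws"
  using assms
proof (induction rule: converse_rtrancl_induct)
  case base
  show ?case by (rule exI[of _ "[j]"]) simp
next
  case (step h i)
  then obtain ws where "ws \<noteq> []" "hd ws = i" "last ws = j" "successively E ws"
    by blast
  then show ?case
    using step(1) by (intro exI[of _ "h # ws"]) (auto simp: successively_Cons)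
qed

text \<open>The potential of \<open>i\<close> is the sum along any walk from \<open>i\<close> to a fixed root: one such walk followed
  by the reverse of another is closed, so the choice of walk does not matter.\<close>

lemma potential_exists:
  fixes E :: "'v \<Rightarrow> 'v \<Rightarrow> bool"
  assumes connected: "\<And>i j. (i, j) \<in> {(k, l). E k l}\<^sup>*"
    and sym: "\<And>i j. E i j \<Longrightarrow> E j i"
    and antisym: "\<And>i j. E i j \<Longrightarrow> D j i = - D i j"
    and cycles: "\<And>vs. vs \<noteq> [] \<Longrightarrow> distinct vs \<Longrightarrow> successively E vs \<Longrightarrow> E (last vs) (hd vs)
      \<Longrightarrow> walk_sum D (vs @ [hd vs]) = 0"
  shows "\<exists>p. \<forall>i j. E i j \<longrightarrow> D i j = p i - p j"
proof -
  obtain r :: 'v where True by blast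
  have path_independent: "walk_sum D vs = walk_sum D ws"
    if vs_walk: "vs \<noteq> []" "last vs = r" "successively E vs"
      and ws_walk: "ws \<noteq> []" "last ws = r" "successively E ws" and start: "hd vs = hd ws" for vs ws
  proof -
    obtain vs' where vs: "vs = vs' @ [r]"
      using vs_walk by (metis append_butlast_last_id)
    obtain ws' where ws: "ws = ws' @ [r]"
      using ws_walk by (metis append_butlast_last_id)
    have "successively E (rev ws)"
      unfolding successively_rev using ws_walk(3) by (rule successively_mono) (rule sym)
    then have "successively E (vs' @ r # rev ws')"
      using vs_walk(3) unfolding vs ws by (auto simp: successively_append_iff successively_Cons)
    moreover have "last (vs' @ r # rev ws') = hd (vs' @ r # rev ws')"
      using start unfolding vs ws by (cases vs'; cases ws') auto
    ultimately have "walk_sum D (vs' @ r # rev ws') = 0"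
      by (intro walk_sum_closed_walk_eq_0[OF cycles]) auto
    then have "walk_sum D vs + walk_sum D (rev ws) = 0"
      unfolding vs ws using walk_sum_append[of D vs' r "rev ws'"] by simp
    then show ?thesis
      using walk_sum_rev[OF antisym ws_walk(3)] by simp
  qed
  define W where
    "W = (\<lambda>i. SOME ws. ws \<noteq> [] \<and> hd ws = i \<and> last ws = r \<and> successively E ws)"
  have W: "W i \<noteq> [] \<and> hd (W i) = i \<and> last (W i) = r \<and> successively E (W i)" for i
    unfolding W_def by (rule someI_ex[OF walk_exists[OF connected]])
  have "D i j = walk_sum D (W i) - walk_sum D (W j)" if "E i j" for i j
  proof -
    have "walk_sum D (W i) = walk_sum D (i # W j)"
      using W[of i] W[of j] that by (intro path_independent) (auto simp: successively_Cons)
    also have "\<dots> = D i j + walk_sum D (W j)"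
      using W[of j] by (cases "W j") auto
    finally show ?thesis by simp
  qed
  then show ?thesis by (intro exI[of _ "\<lambda>i. walk_sum D (W i)"]) simp
qed

section \<open>Two states in the same winding cell\<close>

lemma dcc_cong: "\<exists>k::int. dcc x y = x - y + 2 * pi * of_int k"
  using theI'[OF dcc_ex1[of x y]] unfolding dcc_def by blast

lemma dcc_eqI:
  assumes "d = x - y + 2 * pi * of_int k" and "- pi \<le> d" and "d < pi"
  shows "dcc x y = d"
  unfolding dcc_def using assms by (intro the1_equality[OF dcc_ex1]) blast

text \<open>The exclusion of \<open>-\<pi>\<close> matters: a difference of \<open>-\<pi>\<close> stays \<open>-\<pi>\<close> when the arguments are
  exchanged.\<close>

lemma dcc_swap:
  assumes "\<bar>dcc x y\<bar> < pi"
  shows "dcc y x = - dcc x y"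
proof -
  obtain k :: int where "dcc x y = x - y + 2 * pi * of_int k"
    using dcc_cong by blast
  then show ?thesis
    using assms by (intro dcc_eqI[where k = "- k"]) auto
qed

lemma sin_dcc: "sin (dcc x y - c) = sin (x - y - c)"
proof -
  obtain k :: int where "dcc x y = x - y + 2 * pi * of_int k"
    using dcc_cong by blast
  then have "dcc x y - c = (x - y - c) + of_int k * (2 * pi)"
    by simp
  moreover have "sin ((x - y - c) + of_int k * (2 * pi)) = sin (x - y - c)"
    using sin.plus_of_int[of "x - y - c" k] by simp
  ultimately show ?thesis
    by (simp only:)
qed

text \<open>Summation along a cycle is a linear functional of its incidence vector, which is what allows the
  passage from a generating family to all cycles. The factor \<open>2\<close> appears because each arc
  contributes to the entries \<open>(i, j)\<close> and \<open>(j, i)\<close>.\<close>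

lemma sum_cycle_vector:
  fixes D :: "'n::finite \<Rightarrow> 'n \<Rightarrow> real"
  assumes "\<And>i j. D j i = - D i j"
  shows "(\<Sum>i\<in>UNIV. \<Sum>j\<in>UNIV. D i j * cycle_vector vs $ i $ j)
    = 2 * (\<Sum>k<length vs. case_prod D (cycle_arc vs k))"
proof -
  define c where "c = (\<lambda>i j. real (card {k. k < length vs \<and> cycle_arc vs k = (i, j)}))"
  have c: "c i j = (\<Sum>k<length vs. if cycle_arc vs k = (i, j) then 1 else 0)" for i j
    unfolding c_def by (simp add: sum.If_cases Int_def)
  have "(\<Sum>i\<in>UNIV. \<Sum>j\<in>UNIV. D i j * c i j)
      = (\<Sum>i\<in>UNIV. \<Sum>j\<in>UNIV. \<Sum>k<length vs. if cycle_arc vs k = (i, j) then D i j else 0)"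
    unfolding c sum_distrib_left by (intro sum.cong) auto
  also have "\<dots> = (\<Sum>z\<in>UNIV. \<Sum>k<length vs. if cycle_arc vs k = z then case_prod D z else 0)"
    unfolding UNIV_Times_UNIV[symmetric] sum.cartesian_product' by (simp only: prod.case)
  also have "\<dots> = (\<Sum>k<length vs. \<Sum>z\<in>UNIV. if cycle_arc vs k = z then case_prod D z else 0)"
    by (rule sum.swap)
  finally have count: "(\<Sum>i\<in>UNIV. \<Sum>j\<in>UNIV. D i j * c i j)
      = (\<Sum>k<length vs. case_prod D (cycle_arc vs k))"
    by simp
  have "(\<Sum>i\<in>UNIV. \<Sum>j\<in>UNIV. D i j * c j i) = (\<Sum>j\<in>UNIV. \<Sum>i\<in>UNIV. D i j * c j i)"
    by (rule sum.swap)
  also have "\<dots> = - (\<Sum>i\<in>UNIV. \<Sum>j\<in>UNIV. D i j * c i j)"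
    unfolding sum_negf[symmetric] by (intro sum.cong refl) (subst assms, simp)
  finally have opposite: "(\<Sum>i\<in>UNIV. \<Sum>j\<in>UNIV. D i j * c j i)
      = - (\<Sum>i\<in>UNIV. \<Sum>j\<in>UNIV. D i j * c i j)" .
  have "cycle_vector vs $ i $ j = c i j - c j i" for i j
    by (simp add: cycle_vector_def c_def)
  then show ?thesis
    using count opposite by (simp add: right_diff_distrib sum_subtractf)
qed

lemma cycle_sums_eq_0:
  fixes D :: "'n::finite \<Rightarrow> 'n \<Rightarrow> real"
  assumes antisym: "\<And>i j. D j i = - D i j"
    and gen: "generates_cycle_space a \<Sigma>"
    and zero: "\<And>\<sigma>. \<sigma> \<in> set \<Sigma> \<Longrightarrow> (\<Sum>k<length \<sigma>. case_prod D (cycle_arc \<sigma> k)) = 0"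
    and cyc: "is_cycle a vs"
  shows "(\<Sum>k<length vs. case_prod D (cycle_arc vs k)) = 0"
proof -
  define F where "F = (\<lambda>M::real^'n^'n. \<Sum>i\<in>UNIV. \<Sum>j\<in>UNIV. D i j * M $ i $ j)"
  have "linear F"
    unfolding F_def
    by (intro linearI) (simp_all add: distrib_left sum.distrib sum_distrib_left mult.left_commute)
  moreover have "F M = 0" if "M \<in> cycle_vector ` set \<Sigma>" for M
    using that zero sum_cycle_vector[of D, OF antisym] unfolding F_def by auto
  moreover have "cycle_vector vs \<in> span (cycle_vector ` set \<Sigma>)"
    using gen cyc unfolding generates_cycle_space_def cycle_space_def
    by (auto intro: span_base)
  ultimately have "F (cycle_vector vs) = 0"
    by (rule linear_eq_0_on_span)
  then show ?thesis
    using sum_cycle_vector[of D vs, OF antisym] unfolding F_def by simp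
qed

lemma adj_cycle_arc:
  assumes "is_cycle a vs" and "k < length vs" and "cycle_arc vs k = (i, j)"
  shows "adj a i j"
proof (cases "Suc k < length vs")
  case True
  then show ?thesis
    using assms unfolding is_cycle_def simple_path_def cycle_arc_def
    by (auto simp: successively_conv_nth)
next
  case False
  then have "Suc k = length vs" "k = length vs - 1"
    using assms(2) by auto
  then show ?thesis
    using assms unfolding is_cycle_def cycle_arc_def
    by (auto simp: last_conv_nth hd_conv_nth)
qed

lemma winding_cell_potential:
  fixes a :: "real ^ 'n ^ 'n"
  assumes graph: "weighted_graph a" "connected_graph a"
    and "\<gamma> < pi"
    and cyc: "\<forall>\<sigma>\<in>set \<Sigma>. is_cycle a \<sigma>"
    and gen: "generates_cycle_space a \<Sigma>"
    and x: "x \<in> cohesive_winding_cell a \<Sigma> u \<gamma>"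
    and y: "y \<in> cohesive_winding_cell a \<Sigma> u \<gamma>"
  shows "\<exists>p. \<forall>i j. adj a i j \<longrightarrow> dcc (x $ i) (x $ j) - dcc (y $ i) (y $ j) = p i - p j"
proof -
  \<comment> \<open>Non-edges get the value \<open>0\<close>, because there the differences need not be antisymmetric.\<close>
  define D where "D = (\<lambda>i j. if adj a i j
    then dcc (x $ i) (x $ j) - dcc (y $ i) (y $ j) else 0)"
  have sym: "adj a i j \<longleftrightarrow> adj a j i" for i j
    using graph unfolding weighted_graph_def adj_def by metis
  have antisym: "D j i = - D i j" for i j
  proof (cases "adj a i j")
    case True
    then have "\<bar>dcc (x $ i) (x $ j)\<bar> < pi" "\<bar>dcc (y $ i) (y $ j)\<bar> < pi"
      using x y \<open>\<gamma> < pi\<close> unfolding cohesive_winding_cell_def cohesive_set_def by fastforce+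
    from this[THEN dcc_swap] show ?thesis
      using True sym by (simp add: D_def)
  qed (use sym in \<open>simp add: D_def\<close>)
  have basis: "(\<Sum>k<length \<sigma>. case_prod D (cycle_arc \<sigma> k)) = 0" if \<sigma>: "\<sigma> \<in> set \<Sigma>" for \<sigma>
  proof -
    have "map (cycle_winding x) \<Sigma> = map (cycle_winding y) \<Sigma>"
      using x y unfolding cohesive_winding_cell_def winding_cell_def winding_vector_def by simp
    then have w: "cycle_winding x \<sigma> = cycle_winding y \<sigma>"
      using \<sigma> by simp
    have "(\<Sum>k<length \<sigma>. case_prod D (cycle_arc \<sigma> k))
      = (\<Sum>k<length \<sigma>. dcc (x $ fst (cycle_arc \<sigma> k)) (x $ snd (cycle_arc \<sigma> k))
          - dcc (y $ fst (cycle_arc \<sigma> k)) (y $ snd (cycle_arc \<sigma> k)))"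
      using cyc \<sigma> by (intro sum.cong) (auto simp: D_def case_prod_beta intro: adj_cycle_arc)
    then show ?thesis
      using w unfolding cycle_winding_def by (simp add: sum_subtractf)
  qed
  have "\<exists>p. \<forall>i j. adj a i j \<longrightarrow> D i j = p i - p j"
  proof (rule potential_exists)
    fix vs assume "vs \<noteq> []" "distinct vs" "successively (adj a) vs" "adj a (last vs) (hd vs)"
    then have vs: "is_cycle a vs"
      by (simp add: is_cycle_def simple_path_def)
    show "walk_sum D (vs @ [hd vs]) = 0"
      unfolding walk_sum_cycle
      by (rule cycle_sums_eq_0[of D, OF antisym gen _ vs]) (rule basis)
  next
    show "(i, j) \<in> {(k, l). adj a k l}\<^sup>*" for i j
      using graph(2) by (simp add: connected_graph_def)
    show "adj a j i" if "adj a i j" for i j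
      using that sym by blast
    show "D j i = - D i j" for i j
      by (rule antisym)
  qed
  moreover have "D i j = dcc (x $ i) (x $ j) - dcc (y $ i) (y $ j)" if "adj a i j" for i j
    using that by (simp add: D_def)
  ultimately show ?thesis
    by metis
qed

lemma connected_constant:
  assumes "connected_graph a" and "\<And>i j. adj a i j \<Longrightarrow> f i = f j"
  shows "f i = f j"
proof -
  have "(i, j) \<in> {(k, l). adj a k l}\<^sup>*"
    using assms(1) unfolding connected_graph_def by blast
  then show ?thesis
    by induction (use assms(2) in auto)
qed

section \<open>The algebraic connectivity as a Rayleigh quotient\<close>

lemma laplacian_mult_vec:
  fixes a :: "real ^ 'n ^ 'n"
  assumes "weighted_graph a"
  shows "(laplacian a *v p) $ i = (\<Sum>j\<in>UNIV. a $ i $ j * (p $ i - p $ j))"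
proof -
  have "(laplacian a *v p) $ i
      = (\<Sum>j\<in>UNIV. (if i = j then (\<Sum>k\<in>UNIV. a $ i $ k) * p $ i else 0) - a $ i $ j * p $ j)"
    unfolding laplacian_def matrix_vector_mult_def vec_lambda_beta
    using assms by (intro sum.cong) (auto simp: weighted_graph_def)
  then show ?thesis
    by (simp add: sum_subtractf right_diff_distrib sum_distrib_right)
qed

lemma sum_sum_antisym_part:
  fixes g :: "'n::finite \<Rightarrow> 'n \<Rightarrow> real"
  assumes "\<And>i j. g j i = - g i j"
  shows "(\<Sum>i\<in>UNIV. p i * (\<Sum>j\<in>UNIV. g i j)) = (\<Sum>i\<in>UNIV. \<Sum>j\<in>UNIV. (p i - p j) * g i j) / 2"
proof -
  have "(\<Sum>i\<in>UNIV. \<Sum>j\<in>UNIV. p j * g i j) = (\<Sum>j\<in>UNIV. \<Sum>i\<in>UNIV. p j * g i j)"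
    by (rule sum.swap)
  also have "\<dots> = - (\<Sum>i\<in>UNIV. \<Sum>j\<in>UNIV. p i * g i j)"
    unfolding sum_negf[symmetric] by (intro sum.cong refl) (subst assms, simp)
  finally show ?thesis
    by (simp add: left_diff_distrib sum_subtractf flip: sum_distrib_left)
qed

lemma inner_laplacian:
  fixes a :: "real ^ 'n ^ 'n"
  assumes "weighted_graph a"
  shows "p \<bullet> (laplacian a *v p) = (\<Sum>i\<in>UNIV. \<Sum>j\<in>UNIV. a $ i $ j * (p $ i - p $ j)\<^sup>2) / 2"
proof -
  have "p \<bullet> (laplacian a *v p)
      = (\<Sum>i\<in>UNIV. p $ i * (\<Sum>j\<in>UNIV. a $ i $ j * (p $ i - p $ j)))"
    using assms by (simp add: inner_vec_def laplacian_mult_vec)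
  also have "\<dots> = (\<Sum>i\<in>UNIV. \<Sum>j\<in>UNIV. (p $ i - p $ j) * (a $ i $ j * (p $ i - p $ j))) / 2"
  proof (rule sum_sum_antisym_part)
    fix i j
    have "a $ j $ i = a $ i $ j"
      using assms unfolding weighted_graph_def by blast
    then show "a $ j $ i * (p $ j - p $ i) = - (a $ i $ j * (p $ i - p $ j))"
      by (simp add: algebra_simps)
  qed
  finally show ?thesis
    by (simp add: power2_eq_square mult.left_commute)
qed

lemma laplacian_nonneg:
  fixes a :: "real ^ 'n ^ 'n"
  assumes "weighted_graph a"
  shows "0 \<le> p \<bullet> (laplacian a *v p)"
  using assms unfolding inner_laplacian[OF assms] weighted_graph_def
  by (auto intro!: sum_nonneg)

lemma laplacian_form_eq_0_imp_constant:
  fixes a :: "real ^ 'n ^ 'n"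
  assumes "weighted_graph a" and "connected_graph a" and "p \<bullet> (laplacian a *v p) = 0"
  shows "p $ i = p $ j"
proof (rule connected_constant[OF assms(2)])
  fix i j assume "adj a i j"
  have nonneg: "0 \<le> a $ i $ j * (p $ i - p $ j)\<^sup>2" for i j
    using assms(1) unfolding weighted_graph_def by simp
  have "(\<Sum>i\<in>UNIV. \<Sum>j\<in>UNIV. a $ i $ j * (p $ i - p $ j)\<^sup>2) = 0"
    using assms(3) unfolding inner_laplacian[OF assms(1)] by simp
  then have "(\<Sum>j\<in>UNIV. a $ i $ j * (p $ i - p $ j)\<^sup>2) = 0"
    by (subst (asm) sum_nonneg_eq_0_iff) (auto intro!: sum_nonneg nonneg)
  then have "a $ i $ j * (p $ i - p $ j)\<^sup>2 = 0"
    by (subst (asm) sum_nonneg_eq_0_iff) (auto intro!: nonneg)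
  then show "p $ i = p $ j"
    using \<open>adj a i j\<close> by (simp add: adj_def)
qed

lemma laplacian_self_adjoint:
  fixes a :: "real ^ 'n ^ 'n"
  assumes "weighted_graph a"
  shows "v \<bullet> (laplacian a *v w) = (laplacian a *v v) \<bullet> w"
proof -
  have "transpose (laplacian a) = laplacian a"
    using assms by (auto simp: vec_eq_iff transpose_def laplacian_def weighted_graph_def)
  then show ?thesis
    by (metis dot_lmul_matrix vector_transpose_matrix)
qed

lemma poly_charpoly: "poly (charpoly A) t = det (mat t - A)"
  unfolding charpoly_def det_def
  by (simp add: poly_sum poly_prod mat_def if_distrib[of "\<lambda>q. poly q t"] cong: if_cong)

lemma charpoly_root_iff:
  fixes A :: "real ^ 'n ^ 'n"
  shows "poly (charpoly A) t = 0 \<longleftrightarrow> (\<exists>v. v \<noteq> 0 \<and> A *v v = t *\<^sub>R v)"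
proof -
  have "(mat t - A) *v v = t *\<^sub>R v - A *v v" for v
  proof -
    have "mat t *v v = t *\<^sub>R v"
      by (simp add: vec_eq_iff matrix_vector_mult_def mat_def if_distrib[of "\<lambda>x. x * _"] cong: if_cong)
    then show ?thesis
      by (simp add: matrix_vector_mult_diff_rdistrib)
  qed
  then have "(mat t - A) *v v = 0 \<longleftrightarrow> A *v v = t *\<^sub>R v" for v
    by auto
  moreover have "det (mat t - A) = 0 \<longleftrightarrow> \<not> inj ((*v) (mat t - A))"
    by (metis invertible_det_nz invertible_left_inverse matrix_left_invertible_injective)
  ultimately show ?thesis
    unfolding poly_charpoly
    by (metis matrix_left_invertible_injective matrix_left_invertible_ker)
qed

lemma sorted_nth_1_le:
  fixes l :: "real list"
  assumes "sorted l" and "s \<in> set l" and "t \<in> set l" and "s < t"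
  shows "l ! 1 \<le> t"
proof -
  obtain m k where m: "m < length l" "l ! m = s" and k: "k < length l" "l ! k = t"
    using assms by (metis in_set_conv_nth)
  have "m < k"
    using assms m k by (metis leD leI sorted_nth_mono)
  then show ?thesis
    using assms(1) k by (metis One_nat_def Suc_leI bot_nat_0.not_eq_extremum less_nat_zero_code sorted_nth_mono)
qed

text \<open>The vector of ones is in the kernel, so \<open>0 < \<mu>\<close> are two distinct roots of the characteristic
  polynomial and the second entry of the sorted list of roots is at most \<open>\<mu>\<close>. The polynomial must
  not be zero, since the zero polynomial has an empty multiset of roots; it does not vanish at \<open>-1\<close>
  because the Laplacian is positive semidefinite.\<close>

lemma algebraic_connectivity_le_eigenvalue:
  fixes a :: "real ^ 'n ^ 'n"
  assumes "weighted_graph a" and "0 < \<mu>" and "v \<noteq> 0" and "laplacian a *v v = \<mu> *\<^sub>R v"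
  shows "algebraic_connectivity a \<le> \<mu>"
proof -
  let ?L = "laplacian a"
  have "\<not> (\<exists>w. w \<noteq> 0 \<and> ?L *v w = (-1) *\<^sub>R w)"
  proof
    assume "\<exists>w. w \<noteq> 0 \<and> ?L *v w = (-1) *\<^sub>R w"
    then obtain w where "w \<noteq> 0" "?L *v w = (-1) *\<^sub>R w" by blast
    then show False
      using laplacian_nonneg[OF assms(1), of w] by (simp add: inner_gt_zero_iff[symmetric] del: inner_gt_zero_iff)
  qed
  then have "poly (charpoly ?L) (-1) \<noteq> 0"
    by (simp add: charpoly_root_iff)
  then have nz: "charpoly ?L \<noteq> 0"
    by auto
  have "?L *v 1 = 0"
    using assms(1) by (simp add: vec_eq_iff laplacian_mult_vec)
  then have "poly (charpoly ?L) 0 = 0"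
    unfolding charpoly_root_iff by (intro exI[of _ 1]) simp
  moreover have "poly (charpoly ?L) \<mu> = 0"
    unfolding charpoly_root_iff using assms by blast
  ultimately show ?thesis
    using nz assms(2) unfolding algebraic_connectivity_def eigenvalue_list_def
    by (intro sorted_nth_1_le[of _ 0]) auto
qed

text \<open>The Laplacian form attains its minimum \<open>\<mu>\<close> on the unit vectors of mean zero. A minimiser \<open>v\<close> is
  an eigenvector for \<open>\<mu>\<close>, and \<open>\<mu>\<close> is positive because on a connected graph the form vanishes only
  at constant vectors. So \<open>\<mu>\<close> is an eigenvalue as in \<open>algebraic_connectivity_le_eigenvalue\<close>.\<close>

lemma algebraic_connectivity_le_Rayleigh:
  fixes a :: "real ^ 'n ^ 'n"
  assumes graph: "weighted_graph a" "connected_graph a" and "p \<bullet> 1 = 0"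
  shows "algebraic_connectivity a * (p \<bullet> p) \<le> p \<bullet> (laplacian a *v p)"
proof (cases "p = 0")
  case False
  let ?L = "laplacian a"
  define S where "S = {w::real^'n. w \<bullet> 1 = 0} \<inter> sphere 0 1"
  have normalised: "(1 / norm w) *\<^sub>R w \<in> S" if "w \<noteq> 0" "w \<bullet> 1 = 0" for w
    using that by (simp add: S_def)
  have "compact S"
    unfolding S_def
    by (intro closed_Int_compact compact_sphere closed_Collect_eq continuous_intros)
  moreover have "S \<noteq> {}"
    using normalised[OF False assms(3)] by blast
  moreover have "continuous_on S (\<lambda>w. w \<bullet> (?L *v w))"
    by (intro continuous_intros)
  ultimately obtain v where v: "v \<in> S" and min: "\<And>w. w \<in> S \<Longrightarrow> v \<bullet> (?L *v v) \<le> w \<bullet> (?L *v w)"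
    using continuous_attains_inf by metis
  define \<mu> where "\<mu> = v \<bullet> (?L *v v)"
  have v1: "v \<bullet> 1 = 0" "v \<bullet> v = 1" "v \<noteq> 0"
    using v by (auto simp: S_def norm_eq_1)
  have Rayleigh: "\<mu> * (w \<bullet> w) \<le> w \<bullet> (?L *v w)" if "w \<bullet> 1 = 0" for w
  proof (cases "w = 0")
    case False
    then have "\<mu> \<le> ((1 / norm w) *\<^sub>R w) \<bullet> (?L *v ((1 / norm w) *\<^sub>R w))"
      unfolding \<mu>_def using that by (intro min normalised)
    also have "\<dots> = (w \<bullet> (?L *v w)) / (w \<bullet> w)"
      by (simp add: matrix_vector_mult_scaleR power2_norm_eq_inner[symmetric] power2_eq_square)
    finally show ?thesis
      using False by (simp add: pos_le_divide_eq)
  qed simp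
  \<comment> \<open>The residual \<open>r\<close> has mean zero, so it is an admissible direction of variation; minimality of
    \<open>v\<close> in that direction forces it to vanish.\<close>
  define r where "r = ?L *v v - \<mu> *\<^sub>R v"
  have "?L *v 1 = 0"
    using graph by (simp add: vec_eq_iff laplacian_mult_vec)
  then have r1: "r \<bullet> 1 = 0"
    using v1 laplacian_self_adjoint[OF graph(1), of v 1] by (simp add: r_def inner_diff_left)
  have rr: "r \<bullet> r = v \<bullet> (?L *v r) - \<mu> * (v \<bullet> r)"
    unfolding laplacian_self_adjoint[OF graph(1), of v r]
    by (simp add: r_def inner_diff_left)
  define c where "c = r \<bullet> (?L *v r) - \<mu> * (r \<bullet> r)"
  have perturb: "0 \<le> 2 * t * (r \<bullet> r) + t\<^sup>2 * c" for t
  proof -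
    have le: "\<mu> * ((v + t *\<^sub>R r) \<bullet> (v + t *\<^sub>R r)) \<le> (v + t *\<^sub>R r) \<bullet> (?L *v (v + t *\<^sub>R r))"
      using v1 r1 by (intro Rayleigh) (simp add: inner_add_left)
    have "r \<bullet> (?L *v v) = v \<bullet> (?L *v r)"
      using laplacian_self_adjoint[OF graph(1), of r v] by (simp add: inner_commute)
    then have form: "(v + t *\<^sub>R r) \<bullet> (?L *v (v + t *\<^sub>R r))
        = \<mu> + 2 * t * (v \<bullet> (?L *v r)) + t\<^sup>2 * (r \<bullet> (?L *v r))"
      by (simp add: matrix_vector_right_distrib matrix_vector_mult_scaleR inner_add_left
          inner_add_right \<mu>_def power2_eq_square distrib_left)
    have norm: "(v + t *\<^sub>R r) \<bullet> (v + t *\<^sub>R r) = 1 + 2 * t * (v \<bullet> r) + t\<^sup>2 * (r \<bullet> r)"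
      using v1 by (simp add: inner_add_left inner_add_right inner_commute[of r v] power2_eq_square
          distrib_left)
    have "0 \<le> 2 * t * (v \<bullet> (?L *v r) - \<mu> * (v \<bullet> r)) + t\<^sup>2 * c"
      using le unfolding form norm by (simp add: c_def algebra_simps)
    then show ?thesis
      by (simp only: rr)
  qed
  have "r = 0"
  proof (rule ccontr)
    assume "r \<noteq> 0"
    then have rpos: "0 < r \<bullet> r" by simp
    \<comment> \<open>A negative step so small that the linear term beats the quadratic one.\<close>
    define t where "t = - (r \<bullet> r) / (\<bar>c\<bar> + 1)"
    have "t < 0"
      using rpos by (simp add: t_def divide_neg_pos)
    have "\<bar>t\<bar> * (\<bar>c\<bar> + 1) = r \<bullet> r"
      using rpos by (simp add: t_def)
    then have "\<bar>t\<bar> * c < 2 * (r \<bullet> r)"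
      using rpos \<open>t < 0\<close> by (smt (verit) mult_left_mono)
    then have "t * (2 * (r \<bullet> r) + t * c) < 0"
      using \<open>t < 0\<close> by (intro mult_neg_pos) auto
    then show False
      using perturb[of t] by (simp add: algebra_simps power2_eq_square)
  qed
  then have eigen: "?L *v v = \<mu> *\<^sub>R v"
    by (simp add: r_def)
  have "\<mu> \<noteq> 0"
  proof
    assume "\<mu> = 0"
    define s where "s = v $ undefined"
    have const: "v $ i = s" for i
      using laplacian_form_eq_0_imp_constant[OF graph] \<open>\<mu> = 0\<close> unfolding \<mu>_def s_def by blast
    have "v \<bullet> v = (\<Sum>i\<in>UNIV. v $ i * s)"
      by (simp add: inner_vec_def const)
    also have "\<dots> = (v \<bullet> 1) * s"
      by (simp add: inner_vec_def sum_distrib_right)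
    finally show False
      using v1 by simp
  qed
  then have "0 < \<mu>"
    using laplacian_nonneg[OF graph(1), of v] by (simp add: \<mu>_def)
  then have "algebraic_connectivity a * (p \<bullet> p) \<le> \<mu> * (p \<bullet> p)"
    using algebraic_connectivity_le_eigenvalue[OF graph(1) _ v1(3) eigen]
    by (intro mult_right_mono) auto
  also have "\<dots> \<le> p \<bullet> (?L *v p)"
    using assms(3) by (rule Rayleigh)
  finally show ?thesis .
qed simp

section \<open>The energy estimate\<close>

lemma sin_increment:
  fixes s t \<gamma> :: real
  assumes "\<bar>s\<bar> \<le> \<gamma>" and "\<bar>t\<bar> \<le> \<gamma>" and "\<gamma> < pi / 2"
  shows "cos \<gamma> * (s - t)\<^sup>2 \<le> (s - t) * (sin s - sin t)"
proof -
  have less: "cos \<gamma> * (s - t)\<^sup>2 \<le> (s - t) * (sin s - sin t)"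
    if "t < s" "\<bar>s\<bar> \<le> \<gamma>" "\<bar>t\<bar> \<le> \<gamma>" for s t
  proof -
    have "\<exists>z>t. z < s \<and> sin s - sin t = (s - t) * cos z"
      using that(1) by (rule MVT2) (rule DERIV_sin)
    then obtain z where z: "t < z" "z < s" "sin s - sin t = (s - t) * cos z"
      by blast
    have "cos \<gamma> \<le> cos \<bar>z\<bar>"
      using z that assms(3) by (intro cos_monotone_0_pi_le) auto
    then have "(s - t)\<^sup>2 * cos \<gamma> \<le> (s - t)\<^sup>2 * cos z"
      by (intro mult_left_mono) auto
    then show ?thesis
      unfolding z(3) by (simp add: power2_eq_square mult_ac)
  qed
  consider "t < s" | "s < t" | "s = t" by linarith
  then show ?thesis
  proof cases
    case 2
    then show ?thesis
      using less[of s t] assms by (simp add: power2_commute algebra_simps)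
  qed (use less assms in auto)
qed

lemma cos_increment:
  fixes s t \<gamma> :: real
  assumes "\<bar>s\<bar> \<le> \<gamma>" and "\<bar>t\<bar> \<le> \<gamma>" and "\<gamma> < pi / 2"
  shows "\<bar>cos s - cos t\<bar> \<le> sin \<gamma> * \<bar>s - t\<bar>"
proof -
  have less: "\<bar>cos s - cos t\<bar> \<le> sin \<gamma> * \<bar>s - t\<bar>"
    if "t < s" "\<bar>s\<bar> \<le> \<gamma>" "\<bar>t\<bar> \<le> \<gamma>" for s t
  proof -
    have "\<exists>z>t. z < s \<and> cos s - cos t = (s - t) * - sin z"
      using that(1) by (rule MVT2) (rule DERIV_cos)
    then obtain z where z: "t < z" "z < s" "cos s - cos t = (s - t) * - sin z"
      by blast
    have "sin z \<le> sin \<gamma>" "sin (- z) \<le> sin \<gamma>"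
      using z that assms(3) by (intro sin_monotone_2pi_le; auto)+
    then have "\<bar>s - t\<bar> * \<bar>sin z\<bar> \<le> \<bar>s - t\<bar> * sin \<gamma>"
      by (intro mult_left_mono) auto
    then show ?thesis
      unfolding z(3) by (simp add: abs_mult mult_ac)
  qed
  consider "t < s" | "s < t" | "s = t" by linarith
  then show ?thesis
  proof cases
    case 2
    then show ?thesis
      using less[of s t] assms by (simp add: abs_minus_commute)
  qed (use less assms in auto)
qed

lemma sum_sum_sym_part:
  fixes g :: "'n::finite \<Rightarrow> 'n \<Rightarrow> real"
  assumes "\<And>i j. g j i = g i j"
  shows "(\<Sum>i\<in>UNIV. p i * (\<Sum>j\<in>UNIV. g i j)) = (\<Sum>i\<in>UNIV. \<Sum>j\<in>UNIV. (p i + p j) * g i j) / 2"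
proof -
  have "(\<Sum>i\<in>UNIV. \<Sum>j\<in>UNIV. p j * g i j) = (\<Sum>j\<in>UNIV. \<Sum>i\<in>UNIV. p j * g i j)"
    by (rule sum.swap)
  also have "\<dots> = (\<Sum>i\<in>UNIV. \<Sum>j\<in>UNIV. p i * g i j)"
    by (intro sum.cong refl) (subst assms, simp)
  finally show ?thesis
    by (simp add: distrib_right sum.distrib flip: sum_distrib_left)
qed

lemma weighted_degree_le_max_degree:
  fixes a :: "real ^ 'n ^ 'n"
  shows "weighted_degree a i \<le> max_degree a"
  unfolding max_degree_def by simp

text \<open>The increments of \<open>sin\<close> are antisymmetric in the two ends of an edge, and those of \<open>cos\<close> are
  symmetric. Summation by parts therefore multiplies the former by \<open>p\<^sub>i - p\<^sub>j\<close> and the latter by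
  \<open>p\<^sub>i + p\<^sub>j\<close>. As the increment of \<open>cos\<close> is at most \<open>sin \<gamma> \<bar>p\<^sub>i - p\<^sub>j\<bar>\<close>, the latter products are
  controlled by \<open>\<bar>p\<^sub>i\<^sup>2 - p\<^sub>j\<^sup>2\<bar> \<le> p\<^sub>i\<^sup>2 + p\<^sub>j\<^sup>2\<close>: this is where the degrees come from.\<close>

lemma energy_inequality:
  fixes a :: "real ^ 'n ^ 'n" and p :: "real ^ 'n" and \<theta> \<eta> :: "'n \<Rightarrow> 'n \<Rightarrow> real"
  assumes graph: "weighted_graph a"
    and "0 \<le> \<phi>" and "\<phi> \<le> pi / 2" and "0 \<le> \<gamma>" and "\<gamma> < pi / 2"
    and antisym: "\<And>i j. adj a i j \<Longrightarrow> \<theta> j i = - \<theta> i j" "\<And>i j. adj a i j \<Longrightarrow> \<eta> j i = - \<eta> i j"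
    and bound: "\<And>i j. adj a i j \<Longrightarrow> \<bar>\<theta> i j\<bar> \<le> \<gamma>" "\<And>i j. adj a i j \<Longrightarrow> \<bar>\<eta> i j\<bar> \<le> \<gamma>"
    and potential: "\<And>i j. adj a i j \<Longrightarrow> \<theta> i j - \<eta> i j = p $ i - p $ j"
    and mean: "p \<bullet> 1 = 0"
    and balance: "\<And>i. (\<Sum>j\<in>UNIV. a $ i $ j * (sin (\<theta> i j - \<phi>) - sin (\<eta> i j - \<phi>))) = c"
  shows "cos \<phi> * cos \<gamma> * (p \<bullet> (laplacian a *v p)) \<le> sin \<phi> * sin \<gamma> * max_degree a * (p \<bullet> p)"
proof -
  define A where "A = (\<lambda>i j. a $ i $ j * (sin (\<theta> i j) - sin (\<eta> i j)))"
  define B where "B = (\<lambda>i j. a $ i $ j * (cos (\<theta> i j) - cos (\<eta> i j)))"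
  have nonneg: "0 \<le> a $ i $ j" and asym: "a $ j $ i = a $ i $ j" for i j
    using graph by (auto simp: weighted_graph_def)
  have edge: "a $ i $ j = 0 \<or> adj a i j" for i j
    using nonneg[of i j] by (auto simp: adj_def)
  have A_antisym: "A j i = - A i j" for i j
    using edge[of i j] antisym[of i j] asym[of i j] by (auto simp: A_def algebra_simps)
  have B_sym: "B j i = B i j" for i j
    using edge[of i j] antisym[of i j] asym[of i j] by (auto simp: B_def)

  have "cos \<phi> * (\<Sum>j\<in>UNIV. A i j) - sin \<phi> * (\<Sum>j\<in>UNIV. B i j) = c" for i
    unfolding balance[of i, symmetric] A_def B_def sum_distrib_left sum_subtractf[symmetric]
    by (intro sum.cong) (auto simp: sin_diff algebra_simps)
  then have "(\<Sum>i\<in>UNIV. p $ i * (cos \<phi> * (\<Sum>j\<in>UNIV. A i j) - sin \<phi> * (\<Sum>j\<in>UNIV. B i j)))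
      = c * (p \<bullet> 1)"
    by (simp add: inner_vec_def sum_distrib_left mult.commute)
  then have eq: "cos \<phi> * (\<Sum>i\<in>UNIV. p $ i * (\<Sum>j\<in>UNIV. A i j))
      = sin \<phi> * (\<Sum>i\<in>UNIV. p $ i * (\<Sum>j\<in>UNIV. B i j))"
    using mean by (simp add: right_diff_distrib sum_subtractf sum_distrib_left mult.left_commute)

  have "cos \<gamma> * (p \<bullet> (laplacian a *v p))
      = (\<Sum>i\<in>UNIV. \<Sum>j\<in>UNIV. cos \<gamma> * (a $ i $ j * (p $ i - p $ j)\<^sup>2)) / 2"
    by (simp add: inner_laplacian[OF graph] sum_distrib_left)
  also have "\<dots> \<le> (\<Sum>i\<in>UNIV. \<Sum>j\<in>UNIV. (p $ i - p $ j) * A i j) / 2"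
  proof (intro divide_right_mono sum_mono)
    fix i j
    show "cos \<gamma> * (a $ i $ j * (p $ i - p $ j)\<^sup>2) \<le> (p $ i - p $ j) * A i j"
    proof (cases "adj a i j")
      case True
      then have "cos \<gamma> * (p $ i - p $ j)\<^sup>2 \<le> (p $ i - p $ j) * (sin (\<theta> i j) - sin (\<eta> i j))"
        using sin_increment[OF bound(1) bound(2) assms(5)] potential by metis
      from mult_left_mono[OF this nonneg[of i j]] show ?thesis
        by (simp add: A_def algebra_simps)
    qed (use edge[of i j] in \<open>simp add: A_def\<close>)
  qed simp
  also have "\<dots> = (\<Sum>i\<in>UNIV. p $ i * (\<Sum>j\<in>UNIV. A i j))"
    by (rule sum_sum_antisym_part[OF A_antisym, symmetric])
  finally have lower: "cos \<gamma> * (p \<bullet> (laplacian a *v p)) \<le> (\<Sum>i\<in>UNIV. p $ i * (\<Sum>j\<in>UNIV. A i j))" .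

  have "(\<Sum>i\<in>UNIV. p $ i * (\<Sum>j\<in>UNIV. B i j)) = (\<Sum>i\<in>UNIV. \<Sum>j\<in>UNIV. (p $ i + p $ j) * B i j) / 2"
    by (rule sum_sum_sym_part[OF B_sym])
  also have "\<dots> \<le> (\<Sum>i\<in>UNIV. \<Sum>j\<in>UNIV. sin \<gamma> * (a $ i $ j * ((p $ i)\<^sup>2 + (p $ j)\<^sup>2))) / 2"
  proof (intro divide_right_mono sum_mono)
    fix i j
    show "(p $ i + p $ j) * B i j \<le> sin \<gamma> * (a $ i $ j * ((p $ i)\<^sup>2 + (p $ j)\<^sup>2))"
    proof (cases "adj a i j")
      case True
      have sin: "0 \<le> sin \<gamma>"
        using assms(4,5) by (intro sin_ge_zero) auto
      have "(p $ i + p $ j) * (cos (\<theta> i j) - cos (\<eta> i j))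
          \<le> \<bar>p $ i + p $ j\<bar> * \<bar>cos (\<theta> i j) - cos (\<eta> i j)\<bar>"
        by (metis abs_ge_self abs_mult)
      also have "\<dots> \<le> \<bar>p $ i + p $ j\<bar> * (sin \<gamma> * \<bar>p $ i - p $ j\<bar>)"
        using cos_increment[OF bound(1)[OF True] bound(2)[OF True] assms(5)] potential[OF True]
        by (intro mult_left_mono) auto
      also have "\<dots> = sin \<gamma> * \<bar>(p $ i)\<^sup>2 - (p $ j)\<^sup>2\<bar>"
        by (simp add: abs_mult[symmetric] power2_eq_square square_diff_square_factored)
      also have "\<dots> \<le> sin \<gamma> * ((p $ i)\<^sup>2 + (p $ j)\<^sup>2)"
        using sin by (intro mult_left_mono) (auto simp: abs_le_iff)
      finally show ?thesis
        using mult_left_mono[OF _ nonneg[of i j]] by (fastforce simp: B_def mult.left_commute)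
    qed (use edge[of i j] in \<open>simp add: B_def\<close>)
  qed simp
  also have "\<dots> = sin \<gamma> * (\<Sum>i\<in>UNIV. (p $ i)\<^sup>2 * weighted_degree a i)"
    unfolding weighted_degree_def sum_sum_sym_part[of "\<lambda>i j. a $ i $ j", OF asym]
    by (simp add: sum_distrib_left mult.commute)
  also have "\<dots> \<le> sin \<gamma> * (\<Sum>i\<in>UNIV. (p $ i)\<^sup>2 * max_degree a)"
    using assms(4,5)
    by (intro mult_left_mono sum_mono weighted_degree_le_max_degree sin_ge_zero) auto
  also have "\<dots> = sin \<gamma> * max_degree a * (p \<bullet> p)"
    by (simp add: inner_vec_def power2_eq_square sum_distrib_left mult_ac)
  finally have upper: "(\<Sum>i\<in>UNIV. p $ i * (\<Sum>j\<in>UNIV. B i j)) \<le> sin \<gamma> * max_degree a * (p \<bullet> p)" .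

  have "cos \<phi> * (cos \<gamma> * (p \<bullet> (laplacian a *v p))) \<le> sin \<phi> * (sin \<gamma> * max_degree a * (p \<bullet> p))"
    using mult_left_mono[OF lower, of "cos \<phi>"] mult_left_mono[OF upper, of "sin \<phi>"] eq assms(2,3)
    by (simp add: cos_ge_zero sin_ge_zero)
  then show ?thesis
    by (simp add: mult_ac)
qed

lemma gamma_bar_le: "gamma_bar a \<phi> \<le> pi / 2"
  using arctan_ubound by (auto simp: gamma_bar_def intro: less_imp_le)

text \<open>For \<open>\<phi> = 0\<close> the energy inequality says that the Laplacian form of \<open>p\<close> vanishes, and for
  \<open>\<phi> = \<pi> / 2\<close> no admissible \<open>\<gamma>\<close> exists. In between, \<open>\<gamma>\<close> lies below the angle whose tangent is
  \<open>\<lambda>\<^sub>2 / (d\<^sub>m\<^sub>a\<^sub>x tan \<phi>)\<close>, which is exactly what makes the left-hand side of the energy inequality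
  dominate the right-hand side unless \<open>p = 0\<close>.\<close>

lemma potential_constant:
  fixes a :: "real ^ 'n ^ 'n" and p :: "real ^ 'n"
  assumes graph: "weighted_graph a" "connected_graph a"
    and "0 \<le> \<phi>" and "\<phi> \<le> pi / 2" and "0 < \<gamma>" and "\<gamma> < gamma_bar a \<phi>"
    and mean: "p \<bullet> 1 = 0"
    and energy: "cos \<phi> * cos \<gamma> * (p \<bullet> (laplacian a *v p))
      \<le> sin \<phi> * sin \<gamma> * max_degree a * (p \<bullet> p)"
  shows "p $ i = p $ j"
proof (cases "\<phi> = 0")
  case True
  have "0 < cos \<gamma>"
    using assms(5,6) gamma_bar_le[of a \<phi>] by (intro cos_gt_zero_pi) auto
  then have "p \<bullet> (laplacian a *v p) = 0"
    using energy laplacian_nonneg[OF graph(1), of p] True by (simp add: mult_le_0_iff)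
  then show ?thesis
    by (rule laplacian_form_eq_0_imp_constant[OF graph])
next
  case False
  then have \<phi>: "0 < \<phi>" "\<phi> < pi / 2"
    using assms(3-6) by (auto simp: gamma_bar_def split: if_splits)
  have \<gamma>: "0 < \<gamma>" "\<gamma> < pi / 2"
    using assms(5,6) gamma_bar_le[of a \<phi>] by auto
  have pos: "0 < cos \<phi>" "0 < sin \<phi>" "0 < cos \<gamma>" "0 < sin \<gamma>"
    using \<phi> \<gamma> by (auto intro: cos_gt_zero_pi sin_gt_zero)
  define d where "d = max_degree a"
  have "0 \<le> weighted_degree a i"
    using graph(1) by (auto simp: weighted_degree_def weighted_graph_def intro: sum_nonneg)
  then have "0 \<le> d"
    using weighted_degree_le_max_degree[of a i] by (simp add: d_def)
  have "\<gamma> < arctan (algebraic_connectivity a / (d * tan \<phi>))"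
    using assms(6) \<phi> by (simp add: gamma_bar_def d_def)
  then have tan: "tan \<gamma> < algebraic_connectivity a / (d * tan \<phi>)"
    using \<gamma> by (metis arctan_less_iff arctan_tan less_trans minus_less_iff neg_less_0_iff_less pi_half_gt_zero)
  \<comment> \<open>If the maximal degree were \<open>0\<close>, the quotient would be \<open>0\<close> by convention.\<close>
  moreover have "0 < tan \<gamma>"
    using \<gamma> by (rule tan_gt_zero)
  ultimately have "d \<noteq> 0"
    by auto
  then have "0 < d * tan \<phi>"
    using \<open>0 \<le> d\<close> \<phi> by (simp add: tan_gt_zero)
  then have "tan \<gamma> * (d * tan \<phi>) < algebraic_connectivity a"
    using tan by (simp add: pos_less_divide_eq)
  then have strict: "sin \<phi> * sin \<gamma> * d < cos \<phi> * cos \<gamma> * algebraic_connectivity a"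
    using pos by (simp add: tan_def field_simps)
  have "cos \<phi> * cos \<gamma> * (algebraic_connectivity a * (p \<bullet> p)) \<le> sin \<phi> * sin \<gamma> * d * (p \<bullet> p)"
    using mult_left_mono[OF algebraic_connectivity_le_Rayleigh[OF graph mean], of "cos \<phi> * cos \<gamma>"]
      energy pos unfolding d_def by (meson less_imp_le mult_nonneg_nonneg order_trans)
  then have "\<not> 0 < p \<bullet> p"
    using strict by (metis mult.assoc mult_less_cancel_right_pos not_less)
  then show ?thesis
    by simp
qed

section \<open>Uniqueness of the synchronous state\<close>

theorem theorem4:
  fixes a :: "real ^ 'n ^ 'n"
    and \<omega> :: "real ^ 'n"
    and \<phi> \<gamma> :: real
    and \<Sigma> :: "'n list list"
    and u :: "int list"
    and xs xt :: "real ^ 'n"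
  assumes "CARD('n) \<ge> 2"
    and "weighted_graph a"
    and "connected_graph a"
    and "0 \<le> \<phi>" and "\<phi> \<le> pi / 2"
    and "0 < \<gamma>" and "\<gamma> < gamma_bar a \<phi>"
    and "\<forall>\<sigma>\<in>set \<Sigma>. is_cycle a \<sigma>"
    and "generates_cycle_space a \<Sigma>"
    and "length u = length \<Sigma>"
    and "xs \<in> cohesive_winding_cell a \<Sigma> u \<gamma>"
    and "xt \<in> cohesive_winding_cell a \<Sigma> u \<gamma>"
    and "synchronous_state (kuramoto_sakaguchi a \<omega> \<phi>) xs"
    and "synchronous_state (kuramoto_sakaguchi a \<omega> \<phi>) xt"
  shows "\<exists>(\<rho>::real) (l::int ^ 'n). xs - xt = \<rho> *\<^sub>R 1 + (2 * pi) *\<^sub>R (\<chi> i. of_int (l $ i))"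
proof -
  define \<theta> where "\<theta> = (\<lambda>i j. dcc (xs $ i) (xs $ j))"
  define \<eta> where "\<eta> = (\<lambda>i j. dcc (xt $ i) (xt $ j))"
  have "\<gamma> < pi / 2"
    using assms(7) gamma_bar_le[of a \<phi>] by simp
  then have "\<gamma> < pi"
    using pi_gt_zero by linarith
  obtain q where q: "\<And>i j. adj a i j \<Longrightarrow> \<theta> i j - \<eta> i j = q i - q j"
    using winding_cell_potential[OF assms(2,3) \<open>\<gamma> < pi\<close> assms(8,9,11,12)]
    unfolding \<theta>_def \<eta>_def by blast
  define p :: "real ^ 'n" where "p = (\<chi> i. q i - (\<Sum>k\<in>UNIV. q k) / CARD('n))"
  have potential: "\<theta> i j - \<eta> i j = p $ i - p $ j" if "adj a i j" for i j
    using q[OF that] by (simp add: p_def)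
  have mean: "p \<bullet> 1 = 0"
    by (simp add: p_def inner_vec_def sum_subtractf)
  have bound: "\<bar>\<theta> i j\<bar> \<le> \<gamma>" "\<bar>\<eta> i j\<bar> \<le> \<gamma>" if "adj a i j" for i j
    using assms(11,12) that
    unfolding cohesive_winding_cell_def cohesive_set_def \<theta>_def \<eta>_def by auto
  have antisym: "\<theta> j i = - \<theta> i j" "\<eta> j i = - \<eta> i j" if "adj a i j" for i j
    using bound[OF that] \<open>\<gamma> < pi\<close> unfolding \<theta>_def \<eta>_def by (auto intro: dcc_swap)

  obtain \<omega>s \<omega>t where
    "\<And>i. kuramoto_sakaguchi a \<omega> \<phi> xs $ i = \<omega>s" "\<And>i. kuramoto_sakaguchi a \<omega> \<phi> xt $ i = \<omega>t"
    using assms(13,14) unfolding synchronous_state_def by auto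
  then have sync: "\<omega> $ i - (\<Sum>j\<in>UNIV. a $ i $ j * (sin (\<theta> i j - \<phi>) + sin \<phi>)) = \<omega>s"
    "\<omega> $ i - (\<Sum>j\<in>UNIV. a $ i $ j * (sin (\<eta> i j - \<phi>) + sin \<phi>)) = \<omega>t" for i
    unfolding kuramoto_sakaguchi_def \<theta>_def \<eta>_def sin_dcc by simp_all
  have balance:
    "(\<Sum>j\<in>UNIV. a $ i $ j * (sin (\<theta> i j - \<phi>) - sin (\<eta> i j - \<phi>))) = \<omega>t - \<omega>s" for i
    using sync(1)[of i] sync(2)[of i]
    by (simp add: distrib_left right_diff_distrib sum.distrib sum_subtractf)

  have "p $ i = p $ j" for i j
    by (rule potential_constant[OF assms(2-7) mean
      energy_inequality[OF assms(2,4,5) less_imp_le[OF assms(6)] \<open>\<gamma> < pi / 2\<close>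
        antisym bound potential mean balance]])
  then have equal: "\<theta> i j = \<eta> i j" if "adj a i j" for i j
    using potential[OF that] by (metis eq_iff_diff_eq_0)

  \<comment> \<open>The phase shift in units of full turns: its fractional part is the same at all vertices, and its
    integer parts are the components of the integer vector.\<close>
  define e where "e = (\<lambda>i. (xs $ i - xt $ i) / (2 * pi))"
  have e: "2 * pi * e i = xs $ i - xt $ i" for i
    by (simp add: e_def)
  have step: "frac (e i) = frac (e j)" if "adj a i j" for i j
  proof -
    obtain k l :: int where "\<theta> i j = xs $ i - xs $ j + 2 * pi * of_int k"
      "\<eta> i j = xt $ i - xt $ j + 2 * pi * of_int l"
      unfolding \<theta>_def \<eta>_def using dcc_cong by metis
    then have "2 * pi * e i = 2 * pi * (e j + of_int (l - k))"
      using equal[OF that] e[of i] e[of j] by (simp add: algebra_simps)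
    then have "e i = e j + of_int (l - k)"
      by (subst (asm) mult_cancel_left) simp
    then show ?thesis
      by (simp add: frac_def)
  qed
  have "frac (e i) = frac (e undefined)" for i
    by (rule connected_constant[OF assms(3) step])
  then have "e i = frac (e undefined) + of_int \<lfloor>e i\<rfloor>" for i
    by (metis add.commute diff_add_cancel frac_def)
  then have "xs $ i - xt $ i = 2 * pi * frac (e undefined) + 2 * pi * of_int \<lfloor>e i\<rfloor>" for i
    unfolding e[symmetric] by (metis distrib_left)
  then show ?thesis
    by (intro exI[of _ "2 * pi * frac (e undefined)"] exI[of _ "\<chi> i. \<lfloor>e i\<rfloor>"])
      (simp add: vec_eq_iff)
qed

end
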